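(* Let $(G,K)$ be a hypergroup Gelfand pair, let $\gamma:\widehat{G^\natural}\to\mathbb{R}_+=[0,\infty)$ be a measurable function and let $s>0$ be a real number. Assume that $\widehat{G^\natural}$ is equicontinuous and that $(1+\gamma(\cdot)^2)^{-\frac{s}{2}}\in L^2(\widehat{G^\natural})$. If $f\in H^{s,\natural}_\gamma(G)$, then $f$ is continuous.
   Context: Hypergroups. Let $G$ be a locally compact Hausdorff space, $M(G)$ its Radon measures, $M_b(G)$ the bounded Radon measures, $\delta_x$ the point mass at $x$, and $\mathfrak{C}(G)$ the set of compact subspaces of $G$ with the Michael topology. $G$ is a hypergroup if: (1) there is a binary operation $\ast$ (convolution) turning $M_b(G)$ into an associative algebra such that $(\mu,\nu)\mapsto\mu\ast\nu$ is continuous for the cone topology (on nonnegative bounded measures, the weakest topology making $\mu\mapsto\int f\,d\mu$ continuous for $f=1$ and for every continuous compactly supported $f$), $\delta_x\ast\delta_y$ is a probability measure with compact support for all $x,y\in G$, and $(x,y)\mapsto\mathrm{supp}(\delta_x\ast\delta_y)$ is continuous from $G\times G$ to $\mathfrak{C}(G)$; (2) there is a unique $e\in G$ with $\delta_x\ast\delta_e=\delta_e\ast\delta_x=\delta_x$ for all $x$; (3) there is an involutive homeomorphism $x\mapsto x^\diamond$ of $G$ with $(\delta_x\ast\delta_y)^\diamond=\delta_{y^\diamond}\ast\delta_{x^\diamond}$, where $\mu^\diamond(f)=\mu(f^\diamond)$ and $f^\diamond(x)=f(x^\diamond)$; (4) $z\in\mathrm{supp}(\delta_x\ast\delta_y)\iff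 x\in\mathrm{supp}(\delta_z\ast\delta_{y^\diamond})$. A subhypergroup is a nonempty closed subset $H$ with $x^\diamond\in H$ and $\mathrm{supp}(\delta_x\ast\delta_y)\subset H$ for all $x,y\in H$. Write $f(x\ast y)=\int_G f\,d(\delta_x\ast\delta_y)$, and similarly for more factors; for measures, $(\mu\ast\nu)(f)=\int_G\int_G f(x\ast y)\,d\mu(x)\,d\nu(y)$. Gelfand pairs. $G$ is assumed to carry a left Haar measure $dx$ (a nonzero nonnegative Radon measure with $\int_G f(y\ast x)\,dx=\int_G f(x)\,dx$ for all $y\in G$ and all continuous compactly supported $f$), and $K$ is a compact subhypergroup of $G$ with normalized Haar measure $dk$. A function $f$ is $K$-bi-invariant if $f(k_1\ast x\ast k_2)=f(x)$ for all $k_1,k_2\in K$, $x\in G$ (for $L^p$ functions, understood almost everywhere in $x$). Put $f^\natural(x)=\int_K\int_K f(k_1\ast x\ast k_2)\,dk_1\,dk_2$; a measure $\mu$ is $K$-bi-invariant if $\mu(f^\natural)=\mu(f)$ for all continuous compactly supported $f$. $M_c^\natural(G)$ is the set of compactly supported $K$-bi-invariant complex Radon measures. $(G,K)$ is a (hypergroup) Gelfand pair if $(M_c^\natural(G),\ast)$ is commutative. Dual and Fourier transform. $\widehat{G^\natural}$ is the set of bounded continuous $K$-bi-invariant functions $\phi:G\to\mathbb{C}$ with $\phi(e)=1$, $\int_K\phi(x\ast k\ast y)\,dk=\phi(x)\phi(y)$ and $\phi(x^\diamond)=\overline{\phi(x)}$ for all $x,y\in G$, with the topology of uniform convergence on compact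 sets (it is locally compact Hausdorff). For a $K$-bi-invariant integrable $f$, $\widehat f(\phi)=\int_G\phi(x^\diamond)f(x)\,dx$ for $\phi\in\widehat{G^\natural}$. $\pi$ denotes the Plancherel measure: the unique nonnegative measure on $\widehat{G^\natural}$ such that $\int_G|f(x)|^2dx=\int_{\widehat{G^\natural}}|\widehat f(\phi)|^2d\pi(\phi)$ for all $K$-bi-invariant $f\in L^1(G)\cap L^2(G)$. Let $L^{2,\natural}(G)$ be the space of $K$-bi-invariant functions in $L^2(G)$ and $L^2(\widehat{G^\natural})=L^2(\widehat{G^\natural},\pi)$. It is a known fact that the Fourier transform extends to an isometric isomorphism, still written $f\mapsto\widehat f$, from $L^{2,\natural}(G)$ onto $L^2(\widehat{G^\natural})$. The inverse Fourier transform is $f(x)=\int_{\widehat{G^\natural}}\phi(x)\widehat f(\phi)\,d\pi(\phi)$; an $f\in L^{2,\natural}(G)$ with $\widehat f\in L^1(\widehat{G^\natural},\pi)$ is identified with the representative of its almost-everywhere class given by this formula. Sobolev space. $H^{s,\natural}_\gamma(G)=\{f\in L^{2,\natural}(G):\int_{\widehat{G^\natural}}(1+\gamma(\phi)^2)^s|\widehat f(\phi)|^2d\pi(\phi)<\infty\}$, with norm $\|f\|_{H^{s,\natural}_\gamma}=\left(\int_{\widehat{G^\natural}}(1+\gamma(\phi)^2)^s|\widehat f(\phi)|^2d\pi(\phi)\right)^{1/2}$. Equicontinuity. $\widehat{G^\natural}$ is equicontinuous if it is equicontinuous at every $a\in G$: for each $\varepsilon>0$ there is a neighborhood $V_a$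 of $a$ in $G$ such that $|\phi(x)-\phi(a)|<\varepsilon$ for all $x\in V_a$ and all $\phi\in\widehat{G^\natural}$. *)

theory Defs
  imports "HOL-Analysis.Analysis"
begin

section \<open>Radon measures\<close>

text \<open>Nonnegative, possibly unbounded: finite on compact sets, outer regular on Borel sets,
  inner regular on open sets.\<close>

definition radon_measure :: "'b topology \<Rightarrow> 'b measure \<Rightarrow> bool" where
  "radon_measure X M \<longleftrightarrow>
     space M = topspace X \<and>
     sets M = sigma_sets (topspace X) {U. openin X U} \<and>
     (\<forall>C. compactin X C \<longrightarrow> emeasure M C < \<infinity>) \<and>
     (\<forall>A\<in>sets M. emeasure M A = (INF U\<in>{U. openin X U \<and> A \<subseteq> U}. emeasure M U)) \<and>
     (\<forall>U. openin X U \<longrightarrow> emeasure M U = (SUP C\<in>{C. compactin X C \<and> C \<subseteq> U}. emeasure M C))"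

text \<open>A bounded complex Radon measure is a countably additive complex function on the Borel sets
  (automatically of finite total variation) whose total variation is regular. It is extended by
  \<open>0\<close> to non-Borel sets, so that equality of functions is equality of measures. Smallness of
  \<open>\<bar>m\<bar> (U - C)\<close> is expressed through the values of \<open>m\<close> on Borel subsets, which is equivalent
  because \<open>\<bar>m\<bar> E \<le> 4 * (SUP B \<subseteq> E. norm (m B))\<close>.\<close>

type_synonym 'a cmeasure = "'a set \<Rightarrow> complex"

definition Mb :: "'a::t2_space cmeasure set" where
  "Mb = {m.
     (\<forall>A. A \<notin> sets borel \<longrightarrow> m A = 0) \<and>
     (\<forall>A::nat \<Rightarrow> 'a set. range A \<subseteq> sets borel \<longrightarrow> disjoint_family A \<longrightarrow>
        (\<lambda>i. m (A i)) sums m (\<Union>i. A i)) \<and>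
     (\<forall>A\<in>sets borel. \<forall>\<epsilon>>0. \<exists>C U. compact C \<and> open U \<and> C \<subseteq> A \<and> A \<subseteq> U \<and>
        (\<forall>B\<in>sets borel. B \<subseteq> U - C \<longrightarrow> norm (m B) < \<epsilon>))}"

definition Mb_pos :: "'a::t2_space cmeasure set" where
  "Mb_pos = {m \<in> Mb. \<forall>A. m A \<in> \<real>\<^sub>\<ge>\<^sub>0}"

definition point_mass :: "'a::t2_space \<Rightarrow> 'a cmeasure" where
  "point_mass x = (\<lambda>A. if A \<in> sets borel \<and> x \<in> A then 1 else 0)"

text \<open>The positive part of the Jordan decomposition of the real part of \<open>m\<close>;
  for \<open>m \<in> Mb_pos\<close> it is \<open>m\<close> itself.\<close>

definition pos_part :: "'a::t2_space cmeasure \<Rightarrow> 'a measure" where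
  "pos_part m = measure_of UNIV (sets borel)
     (\<lambda>A. SUP B\<in>{B \<in> sets borel. B \<subseteq> A}. ennreal (Re (m B)))"

definition cint :: "'a::t2_space cmeasure \<Rightarrow> ('a \<Rightarrow> complex) \<Rightarrow> complex" where
  "cint m f =
     (\<integral>x. f x \<partial>pos_part m) - (\<integral>x. f x \<partial>pos_part (\<lambda>A. - m A))
     + \<i> * ((\<integral>x. f x \<partial>pos_part (\<lambda>A. - \<i> * m A)) - (\<integral>x. f x \<partial>pos_part (\<lambda>A. \<i> * m A)))"

definition supp :: "'a::t2_space cmeasure \<Rightarrow> 'a set" where
  "supp m = {x. \<forall>U. open U \<and> x \<in> U \<longrightarrow> (\<exists>B\<in>sets borel. B \<subseteq> U \<and> m B \<noteq> 0)}"

definition Cc :: "('a::t2_space \<Rightarrow> complex) set" where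
  "Cc = {f. continuous_on UNIV f \<and> compact (closure {x. f x \<noteq> 0})}"

definition cone_topology :: "'a::t2_space cmeasure topology" where
  "cone_topology = topology_generated_by
     {{m \<in> Mb_pos. cint m f \<in> V} | f V. (f = (\<lambda>_. 1) \<or> f \<in> Cc) \<and> open V}"

definition michael_topology :: "'a::t2_space set topology" where
  "michael_topology = topology_generated_by
     ({{C. compact C \<and> C \<subseteq> V} | V. open V} \<union>
      {{C. compact C \<and> C \<inter> U \<noteq> {}} | U. open U})"

section \<open>Hypergroups\<close>

record 'a hypergroup =
  conv :: "'a cmeasure \<Rightarrow> 'a cmeasure \<Rightarrow> 'a cmeasure"
  unit :: 'a
  invol :: "'a \<Rightarrow> 'a"

abbreviation conv_points :: "'a::t2_space hypergroup \<Rightarrow> 'a \<Rightarrow> 'a \<Rightarrow> 'a cmeasure" where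
  "conv_points G x y \<equiv> conv G (point_mass x) (point_mass y)"

text \<open>\<open>at2 G f x y\<close> and \<open>at3 G f x y z\<close> are $f(x * y)$ and $f(x * y * z)$.\<close>

definition at2 :: "'a::t2_space hypergroup \<Rightarrow> ('a \<Rightarrow> complex) \<Rightarrow> 'a \<Rightarrow> 'a \<Rightarrow> complex" where
  "at2 G f x y = cint (conv_points G x y) f"

definition at3 :: "'a::t2_space hypergroup \<Rightarrow> ('a \<Rightarrow> complex) \<Rightarrow> 'a \<Rightarrow> 'a \<Rightarrow> 'a \<Rightarrow> complex" where
  "at3 G f x y z = cint (conv G (conv_points G x y) (point_mass z)) f"

definition measure_algebra :: "'a::t2_space hypergroup \<Rightarrow> bool" where
  "measure_algebra G \<longleftrightarrow>
     (\<forall>l\<in>Mb. \<forall>m\<in>Mb. conv G l m \<in> Mb) \<and>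
     (\<forall>l\<in>Mb. \<forall>m\<in>Mb. \<forall>n\<in>Mb. conv G (conv G l m) n = conv G l (conv G m n)) \<and>
     (\<forall>l\<in>Mb. \<forall>m\<in>Mb. \<forall>n\<in>Mb.
        conv G (\<lambda>A. l A + m A) n = (\<lambda>A. conv G l n A + conv G m n A) \<and>
        conv G n (\<lambda>A. l A + m A) = (\<lambda>A. conv G n l A + conv G n m A)) \<and>
     (\<forall>c. \<forall>m\<in>Mb. \<forall>n\<in>Mb.
        conv G (\<lambda>A. c * m A) n = (\<lambda>A. c * conv G m n A) \<and>
        conv G m (\<lambda>A. c * n A) = (\<lambda>A. c * conv G m n A))"

text \<open>In the clause for the involution, \<open>\<lambda>A. m (invol G -` A)\<close> is the image of \<open>m\<close> under
  the involution, that is, the measure with $m^\diamond(f) = m(f \circ \mathit{invol})$.\<close>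

definition hypergroup :: "'a::t2_space hypergroup \<Rightarrow> bool" where
  "hypergroup G \<longleftrightarrow>
     locally_compact_space (euclidean :: 'a topology) \<and>
     measure_algebra G \<and>
     continuous_map (prod_topology cone_topology cone_topology) cone_topology
       (\<lambda>(m, n). conv G m n) \<and>
     (\<forall>x y. conv_points G x y \<in> Mb_pos \<and> conv_points G x y UNIV = 1 \<and>
        compact (supp (conv_points G x y))) \<and>
     continuous_map (prod_topology euclidean euclidean) michael_topology
       (\<lambda>(x, y). supp (conv_points G x y)) \<and>
     (\<forall>e. e = unit G \<longleftrightarrow>
        (\<forall>x. conv_points G x e = point_mass x \<and> conv_points G e x = point_mass x)) \<and>
     homeomorphism UNIV UNIV (invol G) (invol G) \<and>
     (\<forall>x y. (\<lambda>A. conv_points G x y (invol G -` A)) = conv_points G (invol G y) (invol G x)) \<and>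
     (\<forall>x y z. z \<in> supp (conv_points G x y) \<longleftrightarrow> x \<in> supp (conv_points G z (invol G y)))"

definition subhypergroup :: "'a::t2_space hypergroup \<Rightarrow> 'a set \<Rightarrow> bool" where
  "subhypergroup G H \<longleftrightarrow> H \<noteq> {} \<and> closed H \<and>
     (\<forall>x\<in>H. invol G x \<in> H) \<and> (\<forall>x\<in>H. \<forall>y\<in>H. supp (conv_points G x y) \<subseteq> H)"

definition left_haar :: "'a::t2_space hypergroup \<Rightarrow> 'a measure \<Rightarrow> bool" where
  "left_haar G \<mu> \<longleftrightarrow> radon_measure euclidean \<mu> \<and> emeasure \<mu> UNIV \<noteq> 0 \<and>
     (\<forall>y. \<forall>f\<in>Cc. (\<integral>x. at2 G f y x \<partial>\<mu>) = (\<integral>x. f x \<partial>\<mu>))"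

text \<open>The Haar measure of a compact subhypergroup \<open>K\<close> is a measure on \<open>G\<close> carried by \<open>K\<close>.\<close>

definition normalized_haar_on :: "'a::t2_space hypergroup \<Rightarrow> 'a set \<Rightarrow> 'a measure \<Rightarrow> bool" where
  "normalized_haar_on G K \<kappa> \<longleftrightarrow> radon_measure euclidean \<kappa> \<and>
     emeasure \<kappa> (- K) = 0 \<and> emeasure \<kappa> K = 1 \<and>
     (\<forall>h\<in>K. \<forall>f\<in>Cc. (\<integral>k. at2 G f h k \<partial>\<kappa>) = (\<integral>k. f k \<partial>\<kappa>))"

section \<open>Gelfand pairs\<close>

definition natural_proj ::
  "'a::t2_space hypergroup \<Rightarrow> 'a measure \<Rightarrow> ('a \<Rightarrow> complex) \<Rightarrow> 'a \<Rightarrow> complex" where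
  "natural_proj G \<kappa> f x = (\<integral>k1. (\<integral>k2. at3 G f k1 x k2 \<partial>\<kappa>) \<partial>\<kappa>)"

text \<open>Compactly supported complex Radon measures are bounded, so they all lie in \<open>Mb\<close>.\<close>

definition Mc_nat :: "'a::t2_space hypergroup \<Rightarrow> 'a measure \<Rightarrow> 'a cmeasure set" where
  "Mc_nat G \<kappa> = {m \<in> Mb. compact (supp m) \<and> (\<forall>f\<in>Cc. cint m (natural_proj G \<kappa> f) = cint m f)}"

text \<open>\<open>\<mu>\<close> and \<open>\<kappa>\<close> are the Haar measures $dx$ of \<open>G\<close> and $dk$ of \<open>K\<close>.\<close>

definition gelfand_pair ::
  "'a::t2_space hypergroup \<Rightarrow> 'a measure \<Rightarrow> 'a set \<Rightarrow> 'a measure \<Rightarrow> bool" where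
  "gelfand_pair G \<mu> K \<kappa> \<longleftrightarrow>
     hypergroup G \<and> left_haar G \<mu> \<and>
     compact K \<and> subhypergroup G K \<and> normalized_haar_on G K \<kappa> \<and>
     (\<forall>m\<in>Mc_nat G \<kappa>. \<forall>n\<in>Mc_nat G \<kappa>. conv G m n = conv G n m)"

section \<open>The dual space and the Fourier transform\<close>

definition dual :: "'a::t2_space hypergroup \<Rightarrow> 'a set \<Rightarrow> 'a measure \<Rightarrow> ('a \<Rightarrow> complex) set" where
  "dual G K \<kappa> = {\<phi>. continuous_on UNIV \<phi> \<and> bounded (range \<phi>) \<and>
     (\<forall>k1\<in>K. \<forall>k2\<in>K. \<forall>x. at3 G \<phi> k1 x k2 = \<phi> x) \<and>
     \<phi> (unit G) = 1 \<and>
     (\<forall>x y. (\<integral>k. at3 G \<phi> x k y \<partial>\<kappa>) = \<phi> x * \<phi> y) \<and>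
     (\<forall>x. \<phi> (invol G x) = cnj (\<phi> x))}"

text \<open>Uniform convergence on compact sets. A continuous function attains its maximum on a compact
  set, so the generating sets are exactly the balls of the seminorms
  \<open>\<psi> \<mapsto> sup\<^bsub>x\<in>C\<^esub> \<bar>\<psi> x\<bar>\<close>.\<close>

definition dual_topology ::
  "'a::t2_space hypergroup \<Rightarrow> 'a set \<Rightarrow> 'a measure \<Rightarrow> ('a \<Rightarrow> complex) topology" where
  "dual_topology G K \<kappa> = topology_generated_by
     {{\<psi> \<in> dual G K \<kappa>. \<forall>x\<in>C. norm (\<psi> x - \<phi> x) < \<epsilon>} | \<phi> C \<epsilon>.
        \<phi> \<in> dual G K \<kappa> \<and> compact C \<and> 0 < \<epsilon>}"

definition equicontinuous_dual :: "'a::t2_space hypergroup \<Rightarrow> 'a set \<Rightarrow> 'a measure \<Rightarrow> bool" where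
  "equicontinuous_dual G K \<kappa> \<longleftrightarrow>
     (\<forall>a. \<forall>\<epsilon>>0. \<exists>V. open V \<and> a \<in> V \<and>
        (\<forall>x\<in>V. \<forall>\<phi>\<in>dual G K \<kappa>. norm (\<phi> x - \<phi> a) < \<epsilon>))"

definition square_integrable :: "'b measure \<Rightarrow> ('b \<Rightarrow> 'c::real_normed_vector) \<Rightarrow> bool" where
  "square_integrable M f \<longleftrightarrow> f \<in> borel_measurable M \<and> integrable M (\<lambda>x. (norm (f x))\<^sup>2)"

definition ae_biinvariant ::
  "'a::t2_space hypergroup \<Rightarrow> 'a measure \<Rightarrow> 'a set \<Rightarrow> ('a \<Rightarrow> complex) \<Rightarrow> bool" where
  "ae_biinvariant G \<mu> K f \<longleftrightarrow> (\<forall>k1\<in>K. \<forall>k2\<in>K. AE x in \<mu>. at3 G f k1 x k2 = f x)"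

text \<open>Elements of the \<open>L\<^sup>p\<close> spaces are represented by functions, not by almost-everywhere
  classes.\<close>

definition L2_nat :: "'a::t2_space hypergroup \<Rightarrow> 'a measure \<Rightarrow> 'a set \<Rightarrow> ('a \<Rightarrow> complex) set" where
  "L2_nat G \<mu> K = {f. square_integrable \<mu> f \<and> ae_biinvariant G \<mu> K f}"

definition fourier ::
  "'a::t2_space hypergroup \<Rightarrow> 'a measure \<Rightarrow> ('a \<Rightarrow> complex) \<Rightarrow> ('a \<Rightarrow> complex) \<Rightarrow> complex" where
  "fourier G \<mu> f \<phi> = (\<integral>x. \<phi> (invol G x) * f x \<partial>\<mu>)"

definition plancherel_measure ::
  "'a::t2_space hypergroup \<Rightarrow> 'a measure \<Rightarrow> 'a set \<Rightarrow> 'a measure \<Rightarrow> ('a \<Rightarrow> complex) measure \<Rightarrow> bool"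
where
  "plancherel_measure G \<mu> K \<kappa> \<pi> \<longleftrightarrow>
     radon_measure (dual_topology G K \<kappa>) \<pi> \<and>
     (\<forall>f\<in>L2_nat G \<mu> K. integrable \<mu> f \<longrightarrow>
        (\<integral>\<^sup>+x. ennreal ((norm (f x))\<^sup>2) \<partial>\<mu>) = (\<integral>\<^sup>+\<phi>. ennreal ((norm (fourier G \<mu> f \<phi>))\<^sup>2) \<partial>\<pi>))"

text \<open>\<open>F\<close> is (a representative of) the Fourier transform of the \<open>L\<^sup>2\<close> function \<open>f\<close>: the Fourier
  transform on \<open>L\<^sup>1 \<inter> L\<^sup>2\<close> is extended by continuity, so \<open>F\<close> is determined up to \<open>\<pi>\<close>-null sets.\<close>

definition has_fourier ::
  "'a::t2_space hypergroup \<Rightarrow> 'a measure \<Rightarrow> 'a set \<Rightarrow> ('a \<Rightarrow> complex) measure \<Rightarrow>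
   ('a \<Rightarrow> complex) \<Rightarrow> (('a \<Rightarrow> complex) \<Rightarrow> complex) \<Rightarrow> bool" where
  "has_fourier G \<mu> K \<pi> f F \<longleftrightarrow>
     f \<in> L2_nat G \<mu> K \<and> square_integrable \<pi> F \<and>
     (\<exists>g::nat \<Rightarrow> 'a \<Rightarrow> complex.
        (\<forall>n. g n \<in> L2_nat G \<mu> K \<and> integrable \<mu> (g n)) \<and>
        (\<lambda>n. \<integral>\<^sup>+x. ennreal ((norm (g n x - f x))\<^sup>2) \<partial>\<mu>) \<longlonglongrightarrow> 0 \<and>
        (\<lambda>n. \<integral>\<^sup>+\<phi>. ennreal ((norm (fourier G \<mu> (g n) \<phi> - F \<phi>))\<^sup>2) \<partial>\<pi>) \<longlonglongrightarrow> 0)"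

definition inverse_fourier ::
  "('a \<Rightarrow> complex) measure \<Rightarrow> (('a \<Rightarrow> complex) \<Rightarrow> complex) \<Rightarrow> 'a \<Rightarrow> complex" where
  "inverse_fourier \<pi> F x = (\<integral>\<phi>. \<phi> x * F \<phi> \<partial>\<pi>)"

definition sobolev ::
  "'a::t2_space hypergroup \<Rightarrow> 'a measure \<Rightarrow> 'a set \<Rightarrow> ('a \<Rightarrow> complex) measure \<Rightarrow>
   (('a \<Rightarrow> complex) \<Rightarrow> real) \<Rightarrow> real \<Rightarrow> ('a \<Rightarrow> complex) set" where
  "sobolev G \<mu> K \<pi> \<gamma> s = {f \<in> L2_nat G \<mu> K. \<exists>F. has_fourier G \<mu> K \<pi> f F \<and>
     (\<integral>\<^sup>+\<phi>. ennreal ((1 + (\<gamma> \<phi>)\<^sup>2) powr s * (norm (F \<phi>))\<^sup>2) \<partial>\<pi>) < \<infinity>}"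

text \<open>The convention on representatives of elements of \<open>L\<^sup>2\<close>: if the Fourier transform is integrable,
  the function meant is the representative given by the inversion formula. Nothing is required of
  \<open>f\<close> if its Fourier transform is not integrable.\<close>

definition standard_representative ::
  "'a::t2_space hypergroup \<Rightarrow> 'a measure \<Rightarrow> 'a set \<Rightarrow> ('a \<Rightarrow> complex) measure \<Rightarrow>
   ('a \<Rightarrow> complex) \<Rightarrow> bool" where
  "standard_representative G \<mu> K \<pi> f \<longleftrightarrow>
     (\<forall>F. has_fourier G \<mu> K \<pi> f F \<and> integrable \<pi> F \<longrightarrow> (\<forall>x. f x = inverse_fourier \<pi> F x))"

end

theory Submission
  imports Defs
begin

text \<open>By the Cauchy--Schwarz inequality the Fourier transform \<open>F\<close> of \<open>f\<close> is integrable, hence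
  \<open>f x = (\<integral>\<phi>. \<phi> x * F \<phi> \<partial>\<pi>)\<close>, and equicontinuity of the dual makes this integral continuous
  in \<open>x\<close>. No uniform bound on the characters is used: equicontinuity alone shows that the set of
  \<open>x\<close> for which \<open>\<phi> \<mapsto> \<phi> x * F \<phi>\<close> is integrable is open and closed, and off this set the
  integral is \<open>0\<close> by convention.\<close>

text \<open>The norm of \<open>F\<close> is the product of \<open>w powr (- s / 2)\<close> and
  \<open>w powr (s / 2) * norm (F x)\<close>, both with integrable square. Bounding the product
  pointwise by the sum of the squares gives an integrable majorant, which is all of Cauchy--Schwarz
  that is required.\<close>

lemma integrable_of_weighted_square_integrable:
  fixes F :: "'b \<Rightarrow> 'c::{banach, second_countable_topology}" and w :: "'b \<Rightarrow> real"
  assumes F: "F \<in> borel_measurable M" and w: "w \<in> borel_measurable M"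
    and pos: "\<And>x. 0 < w x"
    and inv: "square_integrable M (\<lambda>x. w x powr (- s / 2))"
    and fin: "(\<integral>\<^sup>+x. ennreal (w x powr s * (norm (F x))\<^sup>2) \<partial>M) < \<infinity>"
  shows "integrable M F"
proof -
  have "integrable M (\<lambda>x. w x powr s * (norm (F x))\<^sup>2)"
    using F w fin by (intro integrableI_nonneg) auto
  moreover have "integrable M (\<lambda>x. (norm (w x powr (- s / 2)))\<^sup>2)"
    using inv by (simp add: square_integrable_def)
  ultimately have "integrable M (\<lambda>x. (norm (w x powr (- s / 2)))\<^sup>2 + w x powr s * (norm (F x))\<^sup>2)"
    by (rule Bochner_Integration.integrable_add[rotated])
  then show ?thesis
  proof (rule Bochner_Integration.integrable_bound[OF _ F], intro AE_I2)
    fix x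
    define u v where "u = w x powr (- s / 2)" and "v = w x powr (s / 2) * norm (F x)"
    \<comment> \<open>Since \<open>0 powr 0 = 0\<close>, the exponents cancel to \<open>1\<close>
      only because \<open>w x\<close> is nonzero.\<close>
    have "w x powr (- s / 2) * w x powr (s / 2) = 1"
      using pos[of x] by (simp flip: powr_add)
    then have uv: "u * v = norm (F x)"
      by (simp add: u_def v_def flip: mult.assoc)
    have "(w x powr (s / 2))\<^sup>2 = w x powr s"
      unfolding power2_eq_square by (simp flip: powr_add)
    then have v2: "v\<^sup>2 = w x powr s * (norm (F x))\<^sup>2"
      by (simp add: v_def power_mult_distrib)
    have "u * v \<le> u\<^sup>2 + v\<^sup>2"
      using sum_squares_bound[of u v] uv norm_ge_zero[of "F x"] by linarith
    then have "norm (F x) \<le> (norm u)\<^sup>2 + w x powr s * (norm (F x))\<^sup>2"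
      by (simp add: uv v2)
    also have "\<dots> \<le> norm ((norm u)\<^sup>2 + w x powr s * (norm (F x))\<^sup>2)"
      by simp
    finally show "norm (F x)
        \<le> norm ((norm (w x powr (- s / 2)))\<^sup>2 + w x powr s * (norm (F x))\<^sup>2)"
      by (simp only: u_def)
  qed
qed

text \<open>For the empty compact set the condition on a generating set is vacuous, so that set is
  the whole dual.\<close>

lemma topspace_dual_topology:
  "topspace (dual_topology G K \<kappa>) = dual G K \<kappa>" (is "?T = ?D")
proof
  show "?T \<subseteq> ?D"
    by (auto simp: dual_topology_def topology_generated_by_topspace)
  show "?D \<subseteq> ?T"
  proof
    fix \<phi> assume "\<phi> \<in> ?D"
    then have "openin (dual_topology G K \<kappa>) {\<psi> \<in> ?D. \<forall>x\<in>{}. norm (\<psi> x - \<phi> x) < 1}"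
      unfolding dual_topology_def
      by (intro topology_generated_by_Basis CollectI exI[of _ \<phi>] exI[of _ "{}"]
          exI[of _ "1::real"]) simp
    then show "\<phi> \<in> ?T"
      using openin_subset \<open>\<phi> \<in> ?D\<close> by fastforce
  qed
qed

text \<open>Evaluation at a point is continuous because singletons are compact: uniform closeness on
  \<open>{x}\<close> is closeness of the values at \<open>x\<close>.\<close>

lemma openin_dual_evaluation:
  assumes "open U"
  shows "openin (dual_topology G K \<kappa>) {\<phi> \<in> dual G K \<kappa>. \<phi> x \<in> U}"
proof (subst openin_subopen, safe)
  fix \<phi> assume \<phi>: "\<phi> \<in> dual G K \<kappa>" "\<phi> x \<in> U"
  obtain \<epsilon> where \<epsilon>: "0 < \<epsilon>" "\<And>z. dist z (\<phi> x) < \<epsilon> \<Longrightarrow> z \<in> U"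
    using assms \<phi>(2) unfolding open_dist by blast
  let ?B = "{\<psi> \<in> dual G K \<kappa>. \<forall>y\<in>{x}. norm (\<psi> y - \<phi> y) < \<epsilon>}"
  have "openin (dual_topology G K \<kappa>) ?B"
    unfolding dual_topology_def using \<phi>(1) \<epsilon>(1)
    by (intro topology_generated_by_Basis CollectI exI[of _ \<phi>] exI[of _ "{x}"] exI[of _ \<epsilon>]) auto
  moreover have "\<phi> \<in> ?B" "?B \<subseteq> {\<phi> \<in> dual G K \<kappa>. \<phi> x \<in> U}"
    using \<phi> \<epsilon> by (auto simp: dist_norm)
  ultimately show "\<exists>T. openin (dual_topology G K \<kappa>) T \<and> \<phi> \<in> T \<and>
      T \<subseteq> {\<phi> \<in> dual G K \<kappa>. \<phi> x \<in> U}"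
    by blast
qed

lemma radon_measure_space_dual:
  assumes "radon_measure (dual_topology G K \<kappa>) \<pi>"
  shows "space \<pi> = dual G K \<kappa>"
  using assms by (simp add: radon_measure_def topspace_dual_topology)

text \<open>This makes the integrand of the inversion formula measurable: evaluation is continuous,
  and the sets of \<pi> include all open sets of the dual.\<close>

lemma borel_measurable_evaluation:
  assumes "radon_measure (dual_topology G K \<kappa>) \<pi>"
  shows "(\<lambda>\<phi>. \<phi> x) \<in> borel_measurable \<pi>"
proof (rule borel_measurableI)
  fix U :: "complex set" assume "open U"
  have "(\<lambda>\<phi>. \<phi> x) -` U \<inter> space \<pi> = {\<phi> \<in> dual G K \<kappa>. \<phi> x \<in> U}"
    using radon_measure_space_dual[OF assms] by auto
  then show "(\<lambda>\<phi>. \<phi> x) -` U \<inter> space \<pi> \<in> sets \<pi>"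
    using assms openin_dual_evaluation[OF \<open>open U\<close>, of G K \<kappa> x]
    unfolding radon_measure_def by (simp add: sigma_sets.Basic)
qed

lemma continuous_inverse_fourier:
  fixes G :: "'a::t2_space hypergroup"
  assumes radon: "radon_measure (dual_topology G K \<kappa>) \<pi>"
    and equi: "equicontinuous_dual G K \<kappa>" and F: "integrable \<pi> F"
  shows "continuous_on UNIV (inverse_fourier \<pi> F)"
proof -
  let ?h = "\<lambda>x \<phi>. \<phi> x * F \<phi>"
  have meas [measurable]: "?h x \<in> borel_measurable \<pi>" for x
    using borel_measurable_evaluation[OF radon, of x] borel_measurable_integrable[OF F]
    by (rule borel_measurable_times)
  have bound: "AE \<phi> in \<pi>. norm (?h x \<phi> - ?h a \<phi>) \<le> \<delta> * norm (F \<phi>)"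
    if "\<forall>\<phi>\<in>dual G K \<kappa>. norm (\<phi> x - \<phi> a) < \<delta>" for x a \<delta>
  \<comment> \<open>The estimate holds at every point of the space of \<pi>, since this space is
    exactly the dual.\<close>
  proof (rule AE_I2)
    fix \<phi> assume "\<phi> \<in> space \<pi>"
    then have "norm (\<phi> x - \<phi> a) \<le> \<delta>"
      using that radon_measure_space_dual[OF radon] by (simp add: less_imp_le)
    then have "norm ((\<phi> x - \<phi> a) * F \<phi>) \<le> \<delta> * norm (F \<phi>)"
      unfolding norm_mult by (rule mult_right_mono) simp
    then show "norm (?h x \<phi> - ?h a \<phi>) \<le> \<delta> * norm (F \<phi>)"
      by (simp only: left_diff_distrib)
  qed
  \<comment> \<open>Domination by a multiple of \<open>norm (F \<phi>)\<close> makes the difference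
    integrable even when neither term is. Hence the two terms are integrable or not
    together.\<close>
  have diff: "integrable \<pi> (\<lambda>\<phi>. ?h x \<phi> - ?h a \<phi>)"
    if "\<forall>\<phi>\<in>dual G K \<kappa>. norm (\<phi> x - \<phi> a) < \<delta>" for x a \<delta>
  proof (rule Bochner_Integration.integrable_bound)
    show "integrable \<pi> (\<lambda>\<phi>. \<delta> * norm (F \<phi>))"
      using F by simp
    show "AE \<phi> in \<pi>. norm (?h x \<phi> - ?h a \<phi>) \<le> norm (\<delta> * norm (F \<phi>))"
      using bound[OF that] by eventually_elim simp
  qed (rule borel_measurable_diff[OF meas meas])
  have iff: "integrable \<pi> (?h x) \<longleftrightarrow> integrable \<pi> (?h a)"
    if "\<forall>\<phi>\<in>dual G K \<kappa>. norm (\<phi> x - \<phi> a) < \<delta>" for x a \<delta>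
  proof
    assume "integrable \<pi> (?h x)"
    from Bochner_Integration.integrable_diff[OF this diff[OF that]]
    show "integrable \<pi> (?h a)" by simp
  next
    assume "integrable \<pi> (?h a)"
    from Bochner_Integration.integrable_add[OF diff[OF that] this]
    show "integrable \<pi> (?h x)" by simp
  qed
  have close: "dist (inverse_fourier \<pi> F x) (inverse_fourier \<pi> F a) \<le> \<delta> * (\<integral>\<phi>. norm (F \<phi>) \<partial>\<pi>)"
    if \<delta>: "\<forall>\<phi>\<in>dual G K \<kappa>. norm (\<phi> x - \<phi> a) < \<delta>" and "0 < \<delta>" for x a \<delta>
  proof (cases "integrable \<pi> (?h a)")
    case True
    then have "inverse_fourier \<pi> F x - inverse_fourier \<pi> F a = (\<integral>\<phi>. ?h x \<phi> - ?h a \<phi> \<partial>\<pi>)"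
      using iff[OF \<delta>] by (simp add: inverse_fourier_def)
    also have "norm \<dots> \<le> (\<integral>\<phi>. norm (?h x \<phi> - ?h a \<phi>) \<partial>\<pi>)"
      by (rule integral_norm_bound)
    also have "\<dots> \<le> (\<integral>\<phi>. \<delta> * norm (F \<phi>) \<partial>\<pi>)"
      using integrable_norm[OF diff[OF \<delta>]] integrable_mult_right[OF integrable_norm[OF F]]
        bound[OF \<delta>]
      by (rule integral_mono_AE)
    finally show ?thesis
      by (simp add: dist_norm)
  next
    \<comment> \<open>Neither integrand is integrable, so both Bochner integrals take the default
      value \<open>0\<close> and the distance vanishes.\<close>
    case False
    then have "inverse_fourier \<pi> F x = 0" "inverse_fourier \<pi> F a = 0"
      using iff[OF \<delta>] by (simp_all add: inverse_fourier_def not_integrable_integral_eq)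
    then show ?thesis
      using \<open>0 < \<delta>\<close> by simp
  qed
  show ?thesis
    unfolding continuous_on_def
  proof (intro ballI tendstoI)
    fix a :: 'a and \<epsilon> :: real assume "0 < \<epsilon>"
    define I where "I = (\<integral>\<phi>. norm (F \<phi>) \<partial>\<pi>)"
    have "0 \<le> I"
      by (simp add: I_def)
    \<comment> \<open>Adding 1 keeps the denominator positive when \<open>I = 0\<close> and makes
      \<open>\<delta> * I < \<epsilon>\<close> strict.\<close>
    define \<delta> where "\<delta> = \<epsilon> / (I + 1)"
    have "0 < \<delta>"
      using \<open>0 < \<epsilon>\<close> \<open>0 \<le> I\<close> by (simp add: \<delta>_def)
    then have "\<delta> * I < \<delta> * (I + 1)"
      by simp
    also have "\<dots> = \<epsilon>"
      using \<open>0 \<le> I\<close> by (simp add: \<delta>_def)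
    finally have "\<delta> * I < \<epsilon>" .
    obtain V where V: "open V" "a \<in> V"
      "\<And>x. x \<in> V \<Longrightarrow> \<forall>\<phi>\<in>dual G K \<kappa>. norm (\<phi> x - \<phi> a) < \<delta>"
      using equi[unfolded equicontinuous_dual_def, THEN spec, THEN spec, THEN mp, OF \<open>0 < \<delta>\<close>, of a]
      by (elim exE conjE) (rule that, auto)
    have "dist (inverse_fourier \<pi> F x) (inverse_fourier \<pi> F a) < \<epsilon>" if "x \<in> V" for x
      using close[OF V(3)[OF that] \<open>0 < \<delta>\<close>] \<open>\<delta> * I < \<epsilon>\<close> by (simp add: I_def)
    then show "\<forall>\<^sub>F x in at a within UNIV.
        dist (inverse_fourier \<pi> F x) (inverse_fourier \<pi> F a) < \<epsilon>"
      using V(1,2) by (auto simp: eventually_at_topological)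
  qed
qed

theorem theorem3p9:
  fixes G :: "'a::t2_space hypergroup"
    and \<mu> \<kappa> :: "'a measure" and K :: "'a set"
    and \<pi> :: "('a \<Rightarrow> complex) measure"
    and \<gamma> :: "('a \<Rightarrow> complex) \<Rightarrow> real" and s :: real
    and f :: "'a \<Rightarrow> complex"
  assumes "gelfand_pair G \<mu> K \<kappa>"
    and "plancherel_measure G \<mu> K \<kappa> \<pi>"
    and "\<gamma> \<in> borel_measurable \<pi>" and "\<forall>\<phi>\<in>dual G K \<kappa>. 0 \<le> \<gamma> \<phi>"
    and "0 < s"
    and "equicontinuous_dual G K \<kappa>"
    and "square_integrable \<pi> (\<lambda>\<phi>. (1 + (\<gamma> \<phi>)\<^sup>2) powr (- s / 2))"
    and "f \<in> sobolev G \<mu> K \<pi> \<gamma> s"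
    and "standard_representative G \<mu> K \<pi> f"
  shows "continuous_on UNIV f"
proof -
  obtain F where F: "has_fourier G \<mu> K \<pi> f F"
    and fin: "(\<integral>\<^sup>+\<phi>. ennreal ((1 + (\<gamma> \<phi>)\<^sup>2) powr s * (norm (F \<phi>))\<^sup>2) \<partial>\<pi>) < \<infinity>"
    using assms(8) by (auto simp: sobolev_def)
  have "integrable \<pi> F"
  proof (rule integrable_of_weighted_square_integrable[OF _ _ _ assms(7) fin])
    show "F \<in> borel_measurable \<pi>"
      using F by (simp add: has_fourier_def square_integrable_def)
    show "(\<lambda>\<phi>. 1 + (\<gamma> \<phi>)\<^sup>2) \<in> borel_measurable \<pi>"
      using assms(3) by measurable
  qed (simp add: add_pos_nonneg)
  \<comment> \<open>Integrability of \<open>F\<close> activates the convention on representatives,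
    which gives equality at every point and not merely almost everywhere.\<close>
  moreover from this have "f = inverse_fourier \<pi> F"
    using F assms(9) by (auto simp: standard_representative_def)
  ultimately show ?thesis
    using continuous_inverse_fourier assms(2,6) by (auto simp: plancherel_measure_def)
qed

end
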